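(* Let $(X,\tau,\mathcal{I})$ be an ideal topological space and $A\subseteq X$. Then $A$ is $\tau$-open if and only if $A$ is both $\tau^*$-open and $\tau^\sharp$-open.
   Context: An ideal on a set $X$ is a non-empty family $\mathcal{I}\subseteq 2^X$ ($2^X$ is the power set of $X$) closed under taking subsets and finite unions. An ideal topological space $(X,\tau,\mathcal{I})$ is a topological space $(X,\tau)$ together with an ideal $\mathcal{I}$ on $X$. $\tau(x)$ denotes the collection of all open sets containing $x$, and $S^c=X\setminus S$. The local function of $A\subseteq X$ is $A^*=\{x\in X\mid(\forall U\in\tau(x))(U\cap A\notin\mathcal{I})\}$; put $cl^*(A)=A\cup A^*$ and let $\tau^*=\{A\subseteq X\mid cl^*(X\setminus A)=X\setminus A\}$ (the $*$-topology). The sharp function of $A\subseteq X$ is $A^\sharp=\{x\in X\mid(\forall U\in\tau(x))(\exists I\in\mathcal{I}\setminus\{\emptyset\})(I\cap(U\cap A)^c=\emptyset)\}$; put $cl^\sharp(A)=A\cup A^\sharp$ and let $\tau^\sharp=\{A\subseteq X\mid cl^\sharp(X\setminus A)=X\setminus A\}$ (the $\sharp$-topology). A set is $\tau^*$-open (resp. $\tau^\sharp$-open) if it belongs to $\tau^*$ (resp. $\tau^\sharp$). *)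

theory Defs
  imports "HOL-Analysis.Abstract_Topology"
begin

definition ideal_on :: "'a set \<Rightarrow> 'a set set \<Rightarrow> bool" where
  "ideal_on X \<I> \<longleftrightarrow>
     \<I> \<subseteq> Pow X \<and> \<I> \<noteq> {} \<and>
     (\<forall>A\<in>\<I>. \<forall>B. B \<subseteq> A \<longrightarrow> B \<in> \<I>) \<and>
     (\<forall>A\<in>\<I>. \<forall>B\<in>\<I>. A \<union> B \<in> \<I>)"

definition open_nhds :: "'a topology \<Rightarrow> 'a \<Rightarrow> 'a set set" where
  "open_nhds T x = {U. openin T U \<and> x \<in> U}"

definition local_function :: "'a topology \<Rightarrow> 'a set set \<Rightarrow> 'a set \<Rightarrow> 'a set" where
  "local_function T \<I> A = {x \<in> topspace T. \<forall>U \<in> open_nhds T x. U \<inter> A \<notin> \<I>}"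

definition star_closure :: "'a topology \<Rightarrow> 'a set set \<Rightarrow> 'a set \<Rightarrow> 'a set" where
  "star_closure T \<I> A = A \<union> local_function T \<I> A"

(* star_topology and sharp_topology are plain families of subsets, not of type 'a topology;
   being open in them means being a member. *)
definition star_topology :: "'a topology \<Rightarrow> 'a set set \<Rightarrow> 'a set set" where
  "star_topology T \<I> =
     {A. A \<subseteq> topspace T \<and> star_closure T \<I> (topspace T - A) = topspace T - A}"

definition sharp_function :: "'a topology \<Rightarrow> 'a set set \<Rightarrow> 'a set \<Rightarrow> 'a set" where
  "sharp_function T \<I> A =
     {x \<in> topspace T. \<forall>U \<in> open_nhds T x. \<exists>I \<in> \<I> - {{}}. I \<inter> (topspace T - (U \<inter> A)) = {}}"

definition sharp_closure :: "'a topology \<Rightarrow> 'a set set \<Rightarrow> 'a set \<Rightarrow> 'a set" where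
  "sharp_closure T \<I> A = A \<union> sharp_function T \<I> A"

definition sharp_topology :: "'a topology \<Rightarrow> 'a set set \<Rightarrow> 'a set set" where
  "sharp_topology T \<I> =
     {A. A \<subseteq> topspace T \<and> sharp_closure T \<I> (topspace T - A) = topspace T - A}"

end

theory Submission imports Defs begin

text \<open>The two topologies refine the given one for complementary reasons. A point \<open>x\<close> of a
  \<open>\<tau>\<^sup>*\<close>-open set \<open>A\<close> has a neighbourhood \<open>U\<close> whose part outside \<open>A\<close> is small, that is, a member
  of the ideal; a point \<open>x\<close> of a \<open>\<tau>\<^sup>\<sharp>\<close>-open set \<open>A\<close> has a neighbourhood \<open>V\<close> whose part outside
  \<open>A\<close> contains no small set except the empty one. When both hold, the part of \<open>U \<inter> V\<close> outside
  \<open>A\<close> is small and lies in \<open>V - A\<close>, so it is empty and \<open>U \<inter> V\<close> is a neighbourhood of \<open>x\<close> inside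
  \<open>A\<close>. Conversely, an open \<open>A\<close> is itself a neighbourhood of each of its points and has empty
  part outside \<open>A\<close>, which meets both requirements at once.\<close>

lemma mem_star_topology_iff:
  assumes "A \<subseteq> topspace T"
  shows "A \<in> star_topology T \<I> \<longleftrightarrow> (\<forall>x\<in>A. \<exists>U. openin T U \<and> x \<in> U \<and> U - A \<in> \<I>)"
proof -
  have "U \<inter> (topspace T - A) = U - A" if "openin T U" for U
    using openin_subset[OF that] by blast
  then have "local_function T \<I> (topspace T - A) =
      {x \<in> topspace T. \<forall>U. openin T U \<and> x \<in> U \<longrightarrow> U - A \<notin> \<I>}"
    unfolding local_function_def open_nhds_def by auto
  moreover have "A \<in> star_topology T \<I> \<longleftrightarrow> A \<inter> local_function T \<I> (topspace T - A) = {}"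
    using assms by (auto simp: star_topology_def star_closure_def local_function_def)
  ultimately show ?thesis
    using assms by blast
qed

text \<open>Members of \<open>\<I>\<close> must lie in the space here: the sharp function tests \<open>I \<subseteq> U \<inter> B\<close> by
  asking that \<open>I\<close> miss the complement of \<open>U \<inter> B\<close> relative to the space, and this says nothing
  about points of \<open>I\<close> beyond it.\<close>
lemma mem_sharp_topology_iff:
  assumes "\<I> \<subseteq> Pow (topspace T)" and "A \<subseteq> topspace T"
  shows "A \<in> sharp_topology T \<I> \<longleftrightarrow>
    (\<forall>x\<in>A. \<exists>U. openin T U \<and> x \<in> U \<and> (\<forall>I\<in>\<I>. I \<subseteq> U - A \<longrightarrow> I = {}))"
proof -
  have "I \<inter> (topspace T - (U \<inter> (topspace T - A))) = {} \<longleftrightarrow> I \<subseteq> U - A" if "I \<in> \<I>" for I U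
    using assms(1) that by blast
  then have "(\<exists>I\<in>\<I> - {{}}. I \<inter> (topspace T - (U \<inter> (topspace T - A))) = {}) \<longleftrightarrow>
      (\<exists>I\<in>\<I> - {{}}. I \<subseteq> U - A)" for U
    by (intro bex_cong) simp_all
  moreover have "(\<exists>I\<in>\<I> - {{}}. I \<subseteq> U - A) \<longleftrightarrow> \<not> (\<forall>I\<in>\<I>. I \<subseteq> U - A \<longrightarrow> I = {})" for U
    by auto
  ultimately have "x \<in> sharp_function T \<I> (topspace T - A) \<longleftrightarrow>
      \<not> (\<exists>U. openin T U \<and> x \<in> U \<and> (\<forall>I\<in>\<I>. I \<subseteq> U - A \<longrightarrow> I = {}))" if "x \<in> A" for x
    using subsetD[OF assms(2) that] unfolding sharp_function_def open_nhds_def by auto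
  moreover have "sharp_function T \<I> (topspace T - A) \<subseteq> topspace T"
    unfolding sharp_function_def by (rule Collect_restrict)
  then have "A \<in> sharp_topology T \<I> \<longleftrightarrow>
      (\<forall>x\<in>A. x \<notin> sharp_function T \<I> (topspace T - A))"
    using assms(2) by (auto simp: sharp_topology_def sharp_closure_def)
  ultimately show ?thesis
    by (simp only: not_not cong: ball_cong)
qed

theorem theorem6p17:
  fixes T :: "'a topology" and \<I> :: "'a set set" and A :: "'a set"
  assumes "ideal_on (topspace T) \<I>"
    and "A \<subseteq> topspace T"
  shows "openin T A \<longleftrightarrow> A \<in> star_topology T \<I> \<and> A \<in> sharp_topology T \<I>"
proof -
  have sub: "\<I> \<subseteq> Pow (topspace T)"
    using assms(1) unfolding ideal_on_def by (rule conjunct1)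
  have down: "C \<in> \<I>" if "B \<in> \<I>" "C \<subseteq> B" for B C
    using assms(1) that unfolding ideal_on_def by simp
  have empty: "{} \<in> \<I>"
  proof -
    obtain B where "B \<in> \<I>"
      using assms(1) unfolding ideal_on_def by auto
    then show ?thesis
      by (rule down) simp
  qed
  note star = mem_star_topology_iff[OF assms(2)]
    and sharp = mem_sharp_topology_iff[OF sub assms(2)]
  show ?thesis
  proof
    assume "openin T A"
    moreover have "A - A \<in> \<I>" and "\<forall>I\<in>\<I>. I \<subseteq> A - A \<longrightarrow> I = {}"
      using empty by auto
    ultimately show "A \<in> star_topology T \<I> \<and> A \<in> sharp_topology T \<I>"
      unfolding star sharp by blast
  next
    assume fine: "A \<in> star_topology T \<I> \<and> A \<in> sharp_topology T \<I>"
    have "\<exists>W. openin T W \<and> x \<in> W \<and> W \<subseteq> A" if x: "x \<in> A" for x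
    proof -
      obtain U where U: "openin T U" "x \<in> U" "U - A \<in> \<I>"
        using bspec[OF fine[THEN conjunct1, unfolded star] x] by auto
      obtain V where V: "openin T V" "x \<in> V" "\<forall>I\<in>\<I>. I \<subseteq> V - A \<longrightarrow> I = {}"
        using bspec[OF fine[THEN conjunct2, unfolded sharp] x] by (elim exE conjE)
      have "U \<inter> V - A \<in> \<I>"
        by (rule down[OF U(3)]) blast
      then have "U \<inter> V - A = {}"
        by (rule V(3)[rule_format]) blast
      then show ?thesis
        using U(1,2) V(1,2) openin_Int[OF U(1) V(1)] by blast
    qed
    then show "openin T A"
      by (subst openin_subopen) blast
  qed
qed

end
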